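(* Fix an integer $k\ge 3$ and a real number $\varepsilon\in(0,1)$. For every sufficiently large prime $p$ (in terms of $k$ and $\varepsilon$), there is a subset $A\subseteq\mathcal{P}_p$ with $\#A=\lfloor(\#\mathcal{P}_p)^{1-\varepsilon}\rfloor$ such that $A$ contains no nontrivial arithmetic progression of length $k$ over $\mathbb{F}_p$.
   Context: For a prime $p$, $\mathbb{F}_p=\mathbb{Z}/p\mathbb{Z}$ is the finite field with $p$ elements and $\mathbb{F}_p^*=\mathbb{F}_p\setminus\{0\}$. An element $g\in\mathbb{F}_p^*$ is a primitive element of $\mathbb{F}_p$ if it generates the cyclic group $\mathbb{F}_p^*$; $\mathcal{P}_p$ denotes the set of all primitive elements of $\mathbb{F}_p$. $\#A$ denotes the cardinality of $A$. For an integer $3\le k\le p$, a nontrivial arithmetic progression of length $k$ over $\mathbb{F}_p$ is a sequence $x_0,x_0+d,x_0+2d,\ldots,x_0+(k-1)d$ with $x_0\in\mathbb{F}_p$ and $d\in\mathbb{F}_p^*$; $A$ contains it if all its terms lie in $A$. *)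

theory Defs
  imports Complex_Main "HOL-Number_Theory.Number_Theory"
begin

text \<open>The field with \<open>p\<close> elements is \<^const>\<open>residue_ring\<close>, whose carrier is
  \<open>{0..p - 1}\<close> as a set of integers.\<close>

abbreviation Fp :: "nat \<Rightarrow> int ring"
  where "Fp p \<equiv> residue_ring (int p)"

definition primitive_elements :: "nat \<Rightarrow> int set"
  where "primitive_elements p =
    {g \<in> carrier (mult_of (Fp p)). generate (mult_of (Fp p)) {g} = carrier (mult_of (Fp p))}"

definition nontrivial_AP :: "nat \<Rightarrow> nat \<Rightarrow> (nat \<Rightarrow> int) \<Rightarrow> bool"
  where "nontrivial_AP p k x \<longleftrightarrow>
    (\<exists>x0 \<in> carrier (Fp p). \<exists>d \<in> carrier (mult_of (Fp p)).
      \<forall>i<k. x i = x0 \<oplus>\<^bsub>Fp p\<^esub> [i] \<cdot>\<^bsub>Fp p\<^esub> d)"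

text \<open>A sequence of length \<open>k\<close> is represented by the values of a function at indices below \<open>k\<close>.\<close>

definition contains_nontrivial_AP :: "nat \<Rightarrow> nat \<Rightarrow> int set \<Rightarrow> bool"
  where "contains_nontrivial_AP p k A \<longleftrightarrow> (\<exists>x. nontrivial_AP p k x \<and> (\<forall>i<k. x i \<in> A))"

end

theory Submission
  imports Defs "HOL-Real_Asymp.Real_Asymp"
begin

text \<open>
  A set without three-term progressions has no longer ones either, and any subset of it
  inherits this property. So it is enough to find, for large \<open>p\<close>, a subset of the set \<open>P\<close> of
  primitive elements that has at least \<open>(card P) powr (1 - \<epsilon>)\<close> elements and no nontrivial
  three-term progression modulo \<open>p\<close>, and to discard elements until the size is right.

  Only the size of \<open>P\<close> matters, not its arithmetic structure. Behrend's construction gives, for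
  each \<open>\<delta> > 0\<close> and large \<open>p\<close>, a set \<open>B\<close> of at least \<open>p powr (1 - \<delta>)\<close> naturals
  below \<open>p / 2\<close> without three-term progressions (\<open>ap3_free_large\<close>). The sum of two elements of
  \<open>B\<close> does not reach \<open>p\<close>, so \<open>B\<close> is free of progressions modulo \<open>p\<close> as well, and so is
  each of its translates (\<open>ap3_free_mod_translate\<close>). On average over the \<open>p\<close> translates,
  \<open>card P * card B / p\<close> elements of \<open>P\<close> lie in a translate of \<open>B\<close>, hence some translate
  contains at least \<open>card P * p powr (- \<delta>)\<close> of them (\<open>exists_translate_large_inter\<close>).

  This is at least \<open>(card P) powr (1 - \<epsilon>)\<close> as soon as \<open>p powr \<delta> \<le> (card P) powr \<epsilon>\<close>.
  Since \<open>card P = totient (p - 1)\<close> is at least \<open>sqrt ((p - 1) / 2)\<close>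
  (\<open>le_twice_totient_squared\<close>), the choice \<open>\<delta> = \<epsilon> / 4\<close> works for large \<open>p\<close>.
\<close>


section \<open>Large sets of integers without three-term progressions\<close>

definition ap3_free :: "nat set \<Rightarrow> bool"
  where "ap3_free B \<longleftrightarrow> (\<forall>x\<in>B. \<forall>y\<in>B. \<forall>z\<in>B. x + z = 2 * y \<longrightarrow> x = y)"

lemma digit_expansion_less:
  fixes u :: "nat \<Rightarrow> nat"
  assumes "\<And>i. i < n \<Longrightarrow> u i < b"
  shows "(\<Sum>i<n. u i * b ^ i) < b ^ n"
  using assms
proof (induction n)
  case (Suc n)
  have "(\<Sum>i<n. u i * b ^ i) < b ^ n"
    using Suc by simp
  moreover have "u n * b ^ n + b ^ n \<le> b * b ^ n"
    using Suc.prems[of n] mult_le_mono1[of "Suc (u n)" b "b ^ n"] by simp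
  ultimately show ?case by simp
qed simp

lemma digit_expansion_inj:
  fixes u v :: "nat \<Rightarrow> nat"
  assumes "\<And>i. i < n \<Longrightarrow> u i < b" "\<And>i. i < n \<Longrightarrow> v i < b"
    and "(\<Sum>i<n. u i * b ^ i) = (\<Sum>i<n. v i * b ^ i)" and "i < n"
  shows "u i = v i"
  using assms
proof (induction n arbitrary: i)
  case (Suc n)
  have lt: "(\<Sum>i<n. u i * b ^ i) < b ^ n" "(\<Sum>i<n. v i * b ^ i) < b ^ n"
    using Suc.prems(1,2) by (auto intro!: digit_expansion_less)
  have "((\<Sum>i<n. u i * b ^ i) + u n * b ^ n) div b ^ n = u n"
    "((\<Sum>i<n. v i * b ^ i) + v n * b ^ n) div b ^ n = v n"
    using lt by (simp_all add: div_mult_self1[OF gr_implies_not_zero[OF lt(1)]])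
  hence top: "u n = v n"
    using Suc.prems(3) by simp
  hence "(\<Sum>i<n. u i * b ^ i) = (\<Sum>i<n. v i * b ^ i)"
    using Suc.prems(3) by simp
  hence "u i = v i" if "i < n"
    using Suc.prems(1,2) that by (intro Suc.IH) (simp_all add: less_Suc_eq)
  thus ?case
    using top Suc.prems(4) by (cases "i = n") auto
qed simp

text \<open>
  A sphere contains no midpoint of two distinct points of its own. Concretely, if \<open>y\<close> is the
  midpoint of \<open>x\<close> and \<open>z\<close>, the parallelogram identity
  \<open>2 * \<bar>x - y\<bar>\<^sup>2 = \<bar>x\<bar>\<^sup>2 + \<bar>z\<bar>\<^sup>2 - 2 * \<bar>y\<bar>\<^sup>2\<close> makes the
  distance vanish when all three norms agree.
\<close>
lemma sphere_midpoint_trivial: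
  fixes x y z :: "nat \<Rightarrow> nat"
  assumes "\<And>i. i \<in> I \<Longrightarrow> x i + z i = 2 * y i" and "finite I"
    and "(\<Sum>i\<in>I. x i ^ 2) = s" "(\<Sum>i\<in>I. y i ^ 2) = s" "(\<Sum>i\<in>I. z i ^ 2) = s"
    and "i \<in> I"
  shows "x i = y i"
proof -
  have eq: "int (z i) = 2 * int (y i) - int (x i)" if "i \<in> I" for i
    using assms(1)[OF that] by linarith
  have "(\<Sum>i\<in>I. 2 * (int (x i) - int (y i)) ^ 2)
      = (\<Sum>i\<in>I. int (x i) ^ 2 + int (z i) ^ 2 - 2 * int (y i) ^ 2)"
    by (intro sum.cong) (auto simp: eq power2_eq_square algebra_simps)
  also have "\<dots> = int (\<Sum>i\<in>I. x i ^ 2) + int (\<Sum>i\<in>I. z i ^ 2) - 2 * int (\<Sum>i\<in>I. y i ^ 2)"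
    by (simp add: sum.distrib sum_subtractf sum_distrib_left)
  also have "\<dots> = 0"
    using assms(3-5) by simp
  finally have "\<forall>i\<in>I. 2 * (int (x i) - int (y i)) ^ 2 = 0"
    using \<open>finite I\<close> by (subst (asm) sum_nonneg_eq_0_iff) auto
  thus ?thesis
    using \<open>i \<in> I\<close> by auto
qed

text \<open>
  Behrend's construction. The vectors in \<open>{..<d} ^ n\<close> lie on at most \<open>n * d\<^sup>2\<close> spheres
  around the origin, so some sphere contains at least a fraction \<open>1 / (n * d\<^sup>2)\<close> of them.
  Reading vectors as digits in base \<open>2 * d\<close>, the addition of two of them produces no carries;
  a three-term progression of numbers is therefore one of vectors, and the chosen sphere has
  only trivial ones.
\<close>
lemma behrend:
  fixes n d :: nat
  assumes "n > 0" "d > 0"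
  obtains B where "B \<subseteq> {..<(2 * d) ^ n}" "ap3_free B" "d ^ n \<le> card B * (n * d ^ 2)"
proof -
  define V where "V = (\<Pi>\<^sub>E i\<in>{..<n}. {..<d})"
  \<comment> \<open>\<open>q\<close> is the squared Euclidean norm, \<open>e\<close> the base-\<open>2 * d\<close> encoding.\<close>
  define q where "q = (\<lambda>x::nat \<Rightarrow> nat. \<Sum>i<n. x i ^ 2)"
  define e where "e = (\<lambda>x::nat \<Rightarrow> nat. \<Sum>i<n. x i * (2 * d) ^ i)"
  have V: "finite V" "card V = d ^ n"
    by (auto simp: V_def card_PiE intro: finite_PiE)
  have digit: "x i < d" if "x \<in> V" "i < n" for x i
    using that by (auto simp: V_def PiE_def Pi_def)
  have "q x < n * d ^ 2" if "x \<in> V" for x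
  proof -
    have "q x < (\<Sum>i<n. d ^ 2)"
      unfolding q_def using digit[OF that] assms
      by (intro sum_strict_mono) (auto intro!: power_strict_mono)
    thus ?thesis by simp
  qed
  hence "q \<in> V \<rightarrow> {..<n * d ^ 2}"
    by auto
  moreover have "{..<n * d ^ 2} \<noteq> {}"
    using assms by (auto simp: lessThan_empty_iff)
  ultimately obtain s where s: "card (q -` {s} \<inter> V) * (n * d ^ 2) \<ge> d ^ n"
    using pigeonhole_card[of q V "{..<n * d ^ 2}"] V by auto
  define S where "S = q -` {s} \<inter> V"
  have lt: "x i < 2 * d" if "x \<in> V" "i < n" for x i
    using digit[OF that] by simp
  have inj: "x = y" if "x \<in> V" "y \<in> V" "e x = e y" for x y
  proof (rule PiE_ext[of x "{..<n}" "\<lambda>_. {..<d}" y])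
    fix i assume "i \<in> {..<n}"
    thus "x i = y i"
      using digit_expansion_inj[of n x "2 * d" y i] lt[OF that(1)] lt[OF that(2)] that(3)
      unfolding e_def lessThan_iff by blast
  qed (use that in \<open>auto simp: V_def\<close>)
  show thesis
  proof (rule that)
    show "e ` S \<subseteq> {..<(2 * d) ^ n}"
    proof (rule image_subsetI)
      fix x assume "x \<in> S"
      thus "e x \<in> {..<(2 * d) ^ n}"
        unfolding e_def lessThan_iff S_def by (intro digit_expansion_less lt) auto
    qed
    have "card (e ` S) = card S"
      by (intro card_image inj_onI inj) (auto simp: S_def)
    thus "d ^ n \<le> card (e ` S) * (n * d ^ 2)"
      using s by (simp add: S_def)
    show "ap3_free (e ` S)"
      unfolding ap3_free_def
    proof safe
      fix x y z assume xyz: "x \<in> S" "y \<in> S" "z \<in> S" and sum: "e x + e z = 2 * e y"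
      have "(\<Sum>i<n. (x i + z i) * (2 * d) ^ i) = (\<Sum>i<n. (2 * y i) * (2 * d) ^ i)"
        using sum by (simp add: e_def sum_distrib_left sum.distrib algebra_simps)
      moreover have "x i + z i < 2 * d" "2 * y i < 2 * d" if "i < n" for i
        using xyz digit[of x i] digit[of y i] digit[of z i] that unfolding S_def by force+
      ultimately have "x i + z i = 2 * y i" if "i < n" for i
        using digit_expansion_inj[of n "\<lambda>i. x i + z i" "2 * d" "\<lambda>i. 2 * y i" i] that by blast
      hence "x i = y i" if "i < n" for i
        using sphere_midpoint_trivial[of "{..<n}" x z y s i] xyz that by (auto simp: S_def q_def)
      thus "e x = e y"
        by (simp add: e_def)
    qed
  qed
qed

text \<open>
  Any fixed dimension \<open>n\<close> with \<open>2 / n < \<delta>\<close> suffices. The side length \<open>d\<close> is about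
  \<open>m powr (1 / n) / 4\<close>, so that \<open>(2 * d) ^ n \<le> m / 2 ^ n\<close>; the sphere then has at least
  \<open>d ^ (n - 2) / n\<close> points, which is \<open>m powr (1 - 2 / n)\<close> up to a constant depending on
  \<open>n\<close>.
\<close>
lemma ap3_free_large:
  fixes \<delta> :: real
  assumes "\<delta> > 0"
  shows "\<forall>\<^sub>F m :: nat in sequentially.
    \<exists>B. (\<forall>b\<in>B. 2 * b < m) \<and> ap3_free B \<and> real m powr (1 - \<delta>) \<le> real (card B)"
proof -
  obtain N :: nat where "2 / \<delta> < real N"
    using reals_Archimedean2 by blast
  define n where "n = N + 3"
  have "2 / \<delta> < real n"
    using \<open>2 / \<delta> < real N\<close> by (simp add: n_def)
  moreover have "n \<ge> 3"
    by (simp add: n_def)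
  ultimately have n: "n \<ge> 3" "2 / real n < \<delta>"
    using assms by (auto simp: field_simps)
  define r where "r = 1 / real n"
  have r: "r > 0" "2 * r < \<delta>" "r * real n = 1"
    using n by (auto simp: r_def)
  define c where "c = 1 / (8 ^ (n - 2) * real n)"
  have c: "c > 0"
    using n by (simp add: c_def)
  have "\<forall>\<^sub>F m :: nat in sequentially. real m powr r \<ge> 8"
    using r by real_asymp
  moreover have "\<forall>\<^sub>F m :: nat in sequentially. real m powr (1 - \<delta>) \<le> c * real m powr (1 - 2 * r)"
    using r c by real_asymp
  moreover have "\<forall>\<^sub>F m :: nat in sequentially. m > 0"
    by (rule eventually_gt_at_top)
  ultimately show ?thesis
  proof eventually_elim
    case (elim m)
    \<comment> \<open>Since \<open>m powr r \<ge> 8\<close>, rounding down at most halves \<open>m powr r / 4\<close>; this is where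
      the base 8 in \<open>c\<close> comes from.\<close>
    define d where "d = nat \<lfloor>real m powr r / 4\<rfloor>"
    have d: "real d \<le> real m powr r / 4" "real m powr r / 8 \<le> real d" "d > 0"
      using elim(1) unfolding d_def by linarith+
    obtain B where B: "B \<subseteq> {..<(2 * d) ^ n}" "ap3_free B" "d ^ n \<le> card B * (n * d ^ 2)"
      using behrend[of n d] n d by auto
    have mr: "(real m powr r) ^ n = real m"
      using r elim(3) by (simp add: powr_powr flip: powr_realpow)
    have "real ((2 * d) ^ n) = (2 * real d) ^ n"
      by simp
    also have "\<dots> \<le> (real m powr r / 2) ^ n"
      using d by (intro power_mono) auto
    also have "\<dots> = real m / 2 ^ n"
      by (simp add: power_divide mr)
    also have "\<dots> \<le> real m / 2 ^ 1"
      using n by (intro divide_left_mono power_increasing) auto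
    finally have "real (2 * (2 * d) ^ n) \<le> real m"
      by simp
    hence "2 * (2 * d) ^ n \<le> m"
      by (simp only: of_nat_le_iff)
    hence "\<forall>b\<in>B. 2 * b < m"
      using B(1) by fastforce
    moreover have "real m powr (1 - \<delta>) \<le> real (card B)"
    proof -
      have "d ^ (n - 2) * d ^ 2 = d ^ n"
        using n by (simp only: power_add[symmetric] le_add_diff_inverse2[of 2 n])
      hence "d ^ (n - 2) * d ^ 2 \<le> (card B * n) * d ^ 2"
        using B(3) by (simp add: mult.assoc)
      hence "d ^ (n - 2) \<le> card B * n"
        using d(3) by simp
      hence le: "real d ^ (n - 2) \<le> real (card B) * real n"
        by (simp flip: of_nat_power of_nat_mult)
      have "real m powr (1 - 2 * r) = (real m powr r) ^ (n - 2)"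
        using r n elim(3) by (simp add: powr_powr of_nat_diff algebra_simps flip: powr_realpow)
      hence "c * real m powr (1 - 2 * r) = (real m powr r / 8) ^ (n - 2) / real n"
        by (simp add: c_def power_divide)
      also have "\<dots> \<le> real d ^ (n - 2) / real n"
        using d by (intro divide_right_mono power_mono) auto
      also have "\<dots> \<le> real (card B)"
        using le n by (simp add: field_simps)
      finally show ?thesis
        using elim(2) by simp
    qed
    ultimately show ?case
      using B(2) by blast
  qed
qed

section \<open>Translates modulo \<open>m\<close>\<close>

definition ap3_free_mod :: "nat \<Rightarrow> int set \<Rightarrow> bool"
  where "ap3_free_mod m A \<longleftrightarrow>
    (\<forall>x\<in>A. \<forall>y\<in>A. \<forall>z\<in>A. [x + z = 2 * y] (mod int m) \<longrightarrow> [x = y] (mod int m))"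

text \<open>
  Double counting: each \<open>x \<in> P\<close> lies in exactly \<open>card B\<close> of the \<open>m\<close> translates of
  \<open>B\<close> modulo \<open>m\<close>, so the average size of the intersection is \<open>card P * card B / m\<close>.
\<close>
lemma exists_translate_large_inter:
  fixes m :: nat and P :: "int set" and B :: "nat set"
  assumes "finite P" "m > 0" "B \<subseteq> {..<m}"
  obtains t where "card P * card B \<le> m * card {x \<in> P. nat ((x - t) mod int m) \<in> B}"
proof -
  let ?A = "\<lambda>t. {x \<in> P. nat ((x - t) mod int m) \<in> B}"
  have count: "card {t \<in> {0..<int m}. nat ((x - t) mod int m) \<in> B} = card B" for x
  proof (rule bij_betw_same_card[OF bij_betw_byWitness])
    let ?f = "\<lambda>t. nat ((x - t) mod int m)" and ?g = "\<lambda>b. (x - int b) mod int m"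
    show "\<forall>t\<in>{t \<in> {0..<int m}. ?f t \<in> B}. ?g (?f t) = t"
      using assms by (auto simp: mod_simps)
    show "\<forall>b\<in>B. ?f (?g b) = b"
      using assms by (auto simp: mod_simps)
    show "?f ` {t \<in> {0..<int m}. ?f t \<in> B} \<subseteq> B"
      by auto
    show "?g ` B \<subseteq> {t \<in> {0..<int m}. ?f t \<in> B}"
      using assms by (auto simp: mod_simps)
  qed
  have "(\<Sum>t\<in>{0..<int m}. card (?A t)) = (\<Sum>x\<in>P. card {t \<in> {0..<int m}. nat ((x - t) mod int m) \<in> B})"
    by (rule sum_multicount_gen) (use assms in auto)
  hence sum: "(\<Sum>t\<in>{0..<int m}. card (?A t)) = card P * card B"
    unfolding count by simp
  show thesis
  proof (rule ccontr)
    assume "\<not> thesis"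
    hence "m * card (?A t) < card P * card B" for t
      using that[of t] by (meson not_le)
    hence "(\<Sum>t\<in>{0..<int m}. m * card (?A t)) < (\<Sum>t\<in>{0..<int m}. card P * card B)"
      using assms by (intro sum_strict_mono) auto
    thus False
      using sum by (simp flip: sum_distrib_left)
  qed
qed

text \<open>
  The bound \<open>2 * b < m\<close> excludes wrap-around: a congruence between sums of two elements of
  \<open>B\<close> is an equality of naturals.
\<close>
lemma ap3_free_mod_translate:
  assumes "ap3_free B" and half: "\<forall>b\<in>B. 2 * b < m"
  shows "ap3_free_mod m {x. nat ((x - t) mod int m) \<in> B}"
  unfolding ap3_free_mod_def
proof (intro ballI impI)
  fix x y z
  assume xyz: "x \<in> {x. nat ((x - t) mod int m) \<in> B}" "y \<in> {x. nat ((x - t) mod int m) \<in> B}"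
    "z \<in> {x. nat ((x - t) mod int m) \<in> B}"
  assume cong: "[x + z = 2 * y] (mod int m)"
  have m: "m > 0"
    using half xyz(1) by auto
  define r where "r u = nat ((u - t) mod int m)" for u
  have r: "int (r u) = (u - t) mod int m" for u
    using m by (simp add: r_def)
  have rc: "[int (r u) = u - t] (mod int m)" for u
    by (simp add: r)
  have B: "r x \<in> B" "r y \<in> B" "r z \<in> B"
    using xyz by (auto simp: r_def)
  have "[int (r x) + int (r z) = (x - t) + (z - t)] (mod int m)"
    by (intro cong_add rc)
  also have "(x - t) + (z - t) = (x + z) - 2 * t"
    by simp
  also have "[(x + z) - 2 * t = 2 * y - 2 * t] (mod int m)"
    using cong by (intro cong_diff) auto
  also have "2 * y - 2 * t = 2 * (y - t)"
    by simp
  also have "[2 * (y - t) = 2 * int (r y)] (mod int m)"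
    by (intro cong_mult cong_refl cong_sym[OF rc])
  finally have "[int (r x + r z) = int (2 * r y)] (mod int m)"
    by simp
  hence "[r x + r z = 2 * r y] (mod m)"
    unfolding cong_int_iff .
  moreover have "2 * r x < m" "2 * r y < m" "2 * r z < m"
    using half B by auto
  hence "r x + r z < m" "2 * r y < m"
    by linarith+
  ultimately have "r x + r z = 2 * r y"
    by (rule cong_less_modulus_unique_nat)
  hence "r x = r y"
    using assms(1) B by (auto simp: ap3_free_def)
  hence "(x - t) mod int m = (y - t) mod int m"
    using r by metis
  hence "[(x - t) + t = (y - t) + t] (mod int m)"
    by (intro cong_add) (auto simp: Cong.cong_def)
  thus "[x = y] (mod int m)"
    by simp
qed

text \<open>
  The first three terms of a progression of length at least 3 satisfy
  \<open>x 0 + x 2 = 2 * x 1\<close> in the field, so they would force its difference to vanish.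
\<close>
lemma ap3_free_mod_no_AP:
  assumes "prime p" "k \<ge> 3" "ap3_free_mod p A"
  shows "\<not> contains_nontrivial_AP p k A"
proof
  assume "contains_nontrivial_AP p k A"
  then obtain x x0 d where x0: "x0 \<in> carrier (Fp p)" and d: "d \<in> carrier (mult_of (Fp p))"
    and x: "\<And>i. i < k \<Longrightarrow> x i = x0 \<oplus>\<^bsub>Fp p\<^esub> [i] \<cdot>\<^bsub>Fp p\<^esub> d" and A: "\<And>i. i < k \<Longrightarrow> x i \<in> A"
    unfolding contains_nontrivial_AP_def nontrivial_AP_def by blast
  interpret residues_prime p "Fp p"
    by unfold_locales (use assms in auto)
  have d_range: "0 < d" "d < int p" and dR: "d \<in> carrier (Fp p)"
    using d by (auto simp: res_carrier_eq res_zero_eq)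
  have mult: "[i] \<cdot>\<^bsub>Fp p\<^esub> d = (int i * d) mod int p" for i :: nat
  proof (induction i)
    case (Suc i)
    thus ?case
      using dR by (simp add: add.nat_pow_Suc res_add_eq mod_simps algebra_simps)
  qed (simp add: res_zero_eq)
  have x': "[x i = x0 + int i * d] (mod int p)" if "i < k" for i
    using x[OF that] by (simp add: mult res_add_eq Cong.cong_def mod_simps)
  have "[x 0 + x 2 = (x0 + int 0 * d) + (x0 + int 2 * d)] (mod int p)"
    using assms(2) by (intro cong_add x') simp_all
  also have "(x0 + int 0 * d) + (x0 + int 2 * d) = 2 * (x0 + int 1 * d)"
    by simp
  also have "[2 * (x0 + int 1 * d) = 2 * x 1] (mod int p)"
    using assms(2) by (intro cong_mult cong_refl cong_sym[OF x']) simp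
  finally have "[x 0 = x 1] (mod int p)"
    using assms(2,3) A[of 0] A[of 1] A[of 2] unfolding ap3_free_mod_def by force
  hence "[x 1 = x 0] (mod int p)"
    by (rule cong_sym)
  moreover have "[x0 + d = x 1] (mod int p)" "[x 0 = x0 + 0] (mod int p)"
    using cong_sym[OF x'[of 1]] x'[of 0] assms(2) by simp_all
  ultimately have "[x0 + d = x0 + 0] (mod int p)"
    by (blast intro: cong_trans)
  hence "[d = 0] (mod int p)"
    unfolding cong_add_lcancel .
  thus False
    using d_range by (simp add: Cong.cong_def)
qed

section \<open>The number of primitive elements\<close>

text \<open>
  Both \<open>n\<close> and \<open>totient n\<close> factor over the prime powers \<open>q ^ Suc e\<close> that divide \<open>n\<close>
  exactly, with local factors \<open>q ^ Suc e\<close> and \<open>q ^ e * (q - 1)\<close>. For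
  \<open>q \<ge> 3\<close> the inequality \<open>q \<le> (q - 1)\<^sup>2\<close> gives
  \<open>q ^ Suc e \<le> (q ^ e * (q - 1))\<^sup>2\<close>; the prime 2 misses this by a factor of at most 2, and
  this is the factor on the right-hand side.
\<close>
lemma le_twice_totient_squared:
  fixes n :: nat
  shows "n \<le> 2 * totient n ^ 2"
proof (cases "n = 0")
  case False
  let ?F = "\<lambda>q. q ^ (multiplicity q n - 1) * (q - 1)"
  have local_bound: "q ^ multiplicity q n \<le> (if q = 2 then 2 else 1) * ?F q ^ 2"
    if q: "q \<in> prime_factors n" for q
  proof -
    have "q \<ge> 2"
      using q by (auto simp: in_prime_factors_iff prime_ge_2_nat)
    have "multiplicity q n > 0"
      using q by (simp add: prime_factors_multiplicity)
    then obtain e where e: "multiplicity q n = Suc e"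
      by (cases "multiplicity q n") auto
    have "q \<le> (if q = 2 then 2 else 1) * (q - 1) ^ 2"
    proof (cases "q = 2")
      case False
      then obtain r where "q = r + 3"
        using \<open>q \<ge> 2\<close> by (metis add.commute le_Suc_ex le_neq_implies_less Suc_leI numeral_2_eq_2 numeral_3_eq_3)
      thus ?thesis
        by (simp add: power2_eq_square)
    qed simp
    moreover have "q ^ e \<le> (q ^ e) ^ 2"
      using \<open>q \<ge> 2\<close> by (simp add: power2_eq_square)
    ultimately have "q * q ^ e \<le> ((if q = 2 then 2 else 1) * (q - 1) ^ 2) * (q ^ e) ^ 2"
      by (rule mult_le_mono)
    thus ?thesis
      by (simp add: e power_mult_distrib mult_ac)
  qed
  have "n = (\<Prod>q\<in>prime_factors n. q ^ multiplicity q n)"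
    using False by (intro prime_factorization_nat) simp
  also have "\<dots> \<le> (\<Prod>q\<in>prime_factors n. (if q = 2 then 2 else 1) * ?F q ^ 2)"
    using local_bound by (intro prod_mono) auto
  also have "\<dots> = (\<Prod>q\<in>prime_factors n. if q = 2 then 2 else 1) * totient n ^ 2"
    using False by (simp only: totient_formula1 prod_power_distrib prod.distrib[of _ "\<lambda>q. ?F q ^ 2"] neq0_conv)
  also have "(\<Prod>q\<in>prime_factors n. if q = 2 then 2 else 1 :: nat) \<le> 2"
    by (simp add: prod.delta)
  finally show ?thesis
    by simp
qed simp

text \<open>
  An element generates the multiplicative group iff its order is \<open>p - 1\<close>. As this group is
  cyclic, that order occurs, and then it occurs \<open>totient (p - 1)\<close> times.
\<close>
lemma card_primitive_elements:
  assumes "prime p"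
  shows "card (primitive_elements p) = totient (p - 1)"
proof -
  interpret residues_prime p "Fp p"
    by unfold_locales (use assms in auto)
  let ?G = "mult_of (Fp p)"
  interpret G: group ?G
    by (rule field_mult_group)
  have fin: "finite (carrier ?G)"
    by (rule finite_mult_of[OF finite])
  have order: "order ?G = p - 1"
  proof -
    have "carrier ?G = {1..int p - 1}"
      by (auto simp: res_carrier_eq res_zero_eq)
    thus ?thesis
      by (simp add: order_def)
  qed
  have gen_iff: "generate ?G {g} = carrier ?G \<longleftrightarrow> G.ord g = order ?G" if g: "g \<in> carrier ?G" for g
  proof -
    have sub: "generate ?G {g} \<subseteq> carrier ?G"
      using g by (intro G.generate_incl) auto
    have "G.ord g = card (generate ?G {g})"
      using G.generate_pow_card[OF g] .
    thus ?thesis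
      using card_subset_eq[OF fin sub] unfolding order_def by metis
  qed
  obtain a where a: "a \<in> carrier ?G" "carrier ?G = {a [^]\<^bsub>Fp p\<^esub> i | i::nat. i \<in> UNIV}"
    using finite_field_mult_group_has_gen[OF finite] by blast
  have "carrier ?G = generate ?G {a}"
    using G.generate_pow_on_finite_carrier[OF fin a(1)] a(2) by (simp add: nat_pow_mult_of)
  hence "G.ord a = order ?G"
    using gen_iff[OF a(1)] by blast
  hence "card {g \<in> carrier ?G. G.ord g = order ?G} = phi' (order ?G)"
    using a(1) by (intro num_elems_of_ord_eq_phi'[OF finite]) auto
  also have "{g \<in> carrier ?G. G.ord g = order ?G} = primitive_elements p"
    using gen_iff by (auto simp: primitive_elements_def)
  also have "phi' (order ?G) = totient (p - 1)"
    by (auto simp: phi'_def totient_def totatives_def order intro!: arg_cong[of _ _ card])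
  finally show ?thesis .
qed

section \<open>Dense progression-free sets of primitive elements\<close>

theorem theorem1p2:
  fixes k :: nat and \<epsilon> :: real
  assumes "k \<ge> 3" and "0 < \<epsilon>" and "\<epsilon> < 1"
  shows "\<exists>N::nat. \<forall>p::nat. prime p \<and> p \<ge> N \<longrightarrow>
    (\<exists>A \<subseteq> primitive_elements p.
      int (card A) = \<lfloor>real (card (primitive_elements p)) powr (1 - \<epsilon>)\<rfloor> \<and>
      \<not> contains_nontrivial_AP p k A)"
proof -
  have "\<forall>\<^sub>F p :: nat in sequentially. real p powr (\<epsilon> / 4) \<le> ((real p - 1) / 2) powr (\<epsilon> / 2)"
    using assms by real_asymp
  moreover have "\<forall>\<^sub>F p :: nat in sequentially.
    \<exists>B. (\<forall>b\<in>B. 2 * b < p) \<and> ap3_free B \<and> real p powr (1 - \<epsilon> / 4) \<le> real (card B)"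
    using assms by (intro ap3_free_large) auto
  ultimately have "\<forall>\<^sub>F p :: nat in sequentially. prime p \<longrightarrow>
    (\<exists>A \<subseteq> primitive_elements p.
      int (card A) = \<lfloor>real (card (primitive_elements p)) powr (1 - \<epsilon>)\<rfloor> \<and>
      \<not> contains_nontrivial_AP p k A)"
  proof (eventually_elim, intro impI)
    fix p :: nat
    assume elim: "real p powr (\<epsilon> / 4) \<le> ((real p - 1) / 2) powr (\<epsilon> / 2)"
      "\<exists>B. (\<forall>b\<in>B. 2 * b < p) \<and> ap3_free B \<and> real p powr (1 - \<epsilon> / 4) \<le> real (card B)"
      "prime p"
    define P where "P = primitive_elements p"
    have p: "p \<ge> 2"
      using elim(3) by (rule prime_ge_2_nat)
    have card_P: "card P = totient (p - 1)"
      using card_primitive_elements[OF elim(3)] by (simp add: P_def)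
    have P_pos: "card P > 0"
      using p by (simp add: card_P)
    hence fin: "finite P"
      by (rule card_ge_0_finite)
    obtain B where B: "\<forall>b\<in>B. 2 * b < p" "ap3_free B" "real p powr (1 - \<epsilon> / 4) \<le> real (card B)"
      using elim(2) by blast
    have "B \<subseteq> {..<p}"
      using B(1) by fastforce
    then obtain t where t: "card P * card B \<le> p * card {x \<in> P. nat ((x - t) mod int p) \<in> B}"
      using exists_translate_large_inter[OF fin, of p B] p by auto
    define A where "A = {x \<in> P. nat ((x - t) mod int p) \<in> B}"
    have "(real p - 1) / 2 \<le> real (card P) ^ 2"
    proof -
      have "real (p - 1) \<le> real (2 * card P ^ 2)"
        unfolding card_P of_nat_le_iff by (rule le_twice_totient_squared)
      thus ?thesis
        using p by (simp add: of_nat_diff)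
    qed
    hence "((real p - 1) / 2) powr (\<epsilon> / 2) \<le> (real (card P) ^ 2) powr (\<epsilon> / 2)"
      using p assms by (intro powr_mono2) auto
    also have "\<dots> = real (card P) powr \<epsilon>"
      using P_pos by (simp add: powr_powr flip: powr_numeral)
    finally have P_large: "real p powr (\<epsilon> / 4) \<le> real (card P) powr \<epsilon>"
      using elim(1) by simp
    have "real (card P) powr (1 - \<epsilon>) * real p = real (card P) * real p / real (card P) powr \<epsilon>"
      using P_pos by (simp add: powr_diff)
    also have "\<dots> \<le> real (card P) * real p / real p powr (\<epsilon> / 4)"
      using P_large P_pos p by (intro divide_left_mono) auto
    also have "\<dots> = real (card P) * real p powr (1 - \<epsilon> / 4)"
      using p by (simp add: powr_diff)
    also have "\<dots> \<le> real (card P) * real (card B)"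
      using B(3) by (intro mult_left_mono) auto
    also have "\<dots> \<le> real (card A) * real p"
      using t by (simp add: A_def mult.commute flip: of_nat_mult)
    finally have "real (card P) powr (1 - \<epsilon>) \<le> real (card A)"
      using p by simp
    hence "nat \<lfloor>real (card P) powr (1 - \<epsilon>)\<rfloor> \<le> card A"
      by linarith
    then obtain A' where A': "A' \<subseteq> A" "card A' = nat \<lfloor>real (card P) powr (1 - \<epsilon>)\<rfloor>"
      by (rule obtain_subset_with_card_n)
    have "ap3_free_mod p A'"
      using ap3_free_mod_translate[OF B(2,1), of t] A'(1)
      unfolding ap3_free_mod_def A_def by blast
    hence "\<not> contains_nontrivial_AP p k A'"
      using ap3_free_mod_no_AP elim(3) assms(1) by blast
    moreover have "A' \<subseteq> P"
      using A'(1) by (auto simp: A_def)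
    moreover have "int (card A') = \<lfloor>real (card P) powr (1 - \<epsilon>)\<rfloor>"
      using A'(2) by simp
    ultimately show "\<exists>A \<subseteq> primitive_elements p.
        int (card A) = \<lfloor>real (card (primitive_elements p)) powr (1 - \<epsilon>)\<rfloor> \<and>
        \<not> contains_nontrivial_AP p k A"
      unfolding P_def by blast
  qed
  thus ?thesis
    unfolding eventually_sequentially by blast
qed

end
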